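(* Let $G$ be an Abelian group and let $A\subset G$. Then $A$ is unconditionally closed in $G$ if and only if $A$ is algebraic in $G$.
   Context: Unconditionally closed: a subset $A$ of a group $G$ is unconditionally closed in $G$ if it is closed in every Hausdorff group topology on $G$. Algebraic: a subset of a group $G$ with identity $1$ is elementary algebraic in $G$ if it has the form $\{x\in G: w(x)=1\}$ for some word $w=w(x)$ in the alphabet $G\cup\{x,x^{-1}\}$, where $x$ is a variable. A subset is additively algebraic in $G$ if it is a finite (possibly empty) union of elementary algebraic sets. A subset is algebraic in $G$ if it is the intersection of an arbitrary family of additively algebraic sets. *)

theory Defs
  imports "HOL-Analysis.Analysis" "HOL-Algebra.Group"
begin

definition group_topology :: "('a, 'b) monoid_scheme \<Rightarrow> 'a topology \<Rightarrow> bool" where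
  "group_topology G T \<longleftrightarrow>
     topspace T = carrier G \<and>
     continuous_map (prod_topology T T) T (\<lambda>(x, y). x \<otimes>\<^bsub>G\<^esub> y) \<and>
     continuous_map T T (\<lambda>x. inv\<^bsub>G\<^esub> x)"

definition unconditionally_closed_in :: "('a, 'b) monoid_scheme \<Rightarrow> 'a set \<Rightarrow> bool" where
  "unconditionally_closed_in G A \<longleftrightarrow>
     (\<forall>T. group_topology G T \<and> Hausdorff_space T \<longrightarrow> closedin T A)"

datatype 'a letter = Const 'a | Var | Var_inv

primrec letter_value :: "('a, 'b) monoid_scheme \<Rightarrow> 'a \<Rightarrow> 'a letter \<Rightarrow> 'a" where
  "letter_value G x (Const g) = g"
| "letter_value G x Var = x"
| "letter_value G x Var_inv = inv\<^bsub>G\<^esub> x"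

primrec word_value :: "('a, 'b) monoid_scheme \<Rightarrow> 'a \<Rightarrow> 'a letter list \<Rightarrow> 'a" where
  "word_value G x [] = \<one>\<^bsub>G\<^esub>"
| "word_value G x (l # w) = letter_value G x l \<otimes>\<^bsub>G\<^esub> word_value G x w"

definition group_words :: "('a, 'b) monoid_scheme \<Rightarrow> 'a letter list set" where
  "group_words G = lists (Const ` carrier G \<union> {Var, Var_inv})"

definition elementary_algebraic_in :: "('a, 'b) monoid_scheme \<Rightarrow> 'a set \<Rightarrow> bool" where
  "elementary_algebraic_in G A \<longleftrightarrow>
     (\<exists>w \<in> group_words G. A = {x \<in> carrier G. word_value G x w = \<one>\<^bsub>G\<^esub>})"

definition additively_algebraic_in :: "('a, 'b) monoid_scheme \<Rightarrow> 'a set \<Rightarrow> bool" where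
  "additively_algebraic_in G A \<longleftrightarrow>
     (\<exists>\<E>. finite \<E> \<and> (\<forall>E \<in> \<E>. elementary_algebraic_in G E) \<and> A = \<Union>\<E>)"

(* The intersection is taken inside the group, so the empty family yields carrier G;
   carrier G is elementary algebraic anyway, via the empty word. *)
definition algebraic_in :: "('a, 'b) monoid_scheme \<Rightarrow> 'a set \<Rightarrow> bool" where
  "algebraic_in G A \<longleftrightarrow>
     (\<exists>\<F>. (\<forall>B \<in> \<F>. additively_algebraic_in G B) \<and> A = carrier G \<inter> \<Inter>\<F>)"

end

theory Submission
  imports Defs "HOL-Algebra.Multiplicative_Group"
begin

text \<open>
  An algebraic set is closed in every Hausdorff group topology because words are continuous
  functions of their variable and points are closed.

  For the converse, let \<open>A\<close> be non-algebraic, pick a point \<open>p \<notin> A\<close> lying in every additively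
  algebraic set that contains \<open>A\<close>, and put \<open>B = p\<inverse>A\<close>. It suffices to find a Hausdorff group topology
  in which some sequence of elements of \<open>B\<close> converges to \<open>1\<close>: then \<open>p\<close> is a limit of points of \<open>A\<close>.

  Suppose that a sequence \<open>c\<close> is \<^emph>\<open>lacunary\<close>: a relation \<open>\<Prod> c\<^sub>k\<^bsup>e k\<^esup> = 1\<close> with \<open>\<bar>e k\<bar> \<le> 2\<^bsup>k\<^esup>\<close> can hold
  only because each single factor is \<open>1\<close>. Charge \<open>\<Sum> \<bar>e k\<bar> / 2\<^bsup>k\<^esup>\<close> for writing \<open>g\<close> as \<open>\<Prod> c\<^sub>k\<^bsup>e k\<^esup>\<close>, and
  let \<open>N g\<close> be the infimum of these costs and \<open>1\<close>. This is subadditive and symmetric, and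
  \<open>N (c\<^sub>k) \<le> 1 / 2\<^bsup>k\<^esup>\<close>. If \<open>N g = 0\<close>, then \<open>g\<close> has one cheap representation, supported below some \<open>L\<close>,
  and a second one so cheap that its coefficients below \<open>L\<close> vanish. Their quotient is a relation
  with coefficients of absolute value at most \<open>2\<^bsup>k\<^esup>\<close>, so all its factors are trivial and \<open>g = 1\<close>. Hence \<open>N\<close>
  is a norm, and its metric topology is as required (\<open>lacunary_convergent_topology\<close>).

  It remains to find a lacunary sequence in \<open>B\<close> (\<open>lacunary_sequence_exists\<close>). In an Abelian group
  the solution set of a one-variable equation is given by \<open>x\<^bsup>m\<^esup> = a\<close>, and the choice of \<open>p\<close> says
  that \<open>B\<close> is not covered by finitely many such sets with \<open>a \<noteq> 1\<close>. Take \<open>n\<close> minimal for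
  divisibility (\<open>0\<close> being the top element) such that
  \<open>B\<close> restricted to \<open>x\<^bsup>n\<^esup> = 1\<close> still has this property (\<open>minimal_exponent\<close>). By minimality, one can
  then choose \<open>b \<in> B\<close> with \<open>b\<^bsup>n\<^esup> = 1\<close> such that \<open>b\<^bsup>m\<^esup>\<close> avoids any given finite set, simultaneously for
  any finite set of exponents \<open>m\<close> not divisible by \<open>n\<close> (\<open>generic_element\<close>); for the remaining \<open>m\<close>,
  \<open>b\<^bsup>m\<^esup> = 1\<close>. Iterating this choice, always avoiding the finitely many products of small powers of the
  earlier terms, produces the sequence.
\<close>

section \<open>Algebraic sets are unconditionally closed\<close>

lemma (in group) continuous_map_word_value:
  assumes T: "group_topology G T" and w: "w \<in> group_words G"
  shows "continuous_map T T (\<lambda>x. word_value G x w)"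
proof -
  have top: "topspace T = carrier G"
    and mult: "continuous_map (prod_topology T T) T (\<lambda>(x, y). x \<otimes> y)"
    and invc: "continuous_map T T (\<lambda>x. inv x)"
    using T by (auto simp: group_topology_def)
  have "w \<in> lists (Const ` carrier G \<union> {Var, Var_inv})"
    using w by (simp add: group_words_def)
  then show ?thesis
  proof (induction w rule: lists.induct)
    case Nil
    then show ?case using top by simp
  next
    case (Cons l w)
    have l: "continuous_map T T (\<lambda>x. letter_value G x l)"
      using Cons.hyps(1) top invc by auto
    have "continuous_map T (prod_topology T T) (\<lambda>x. (letter_value G x l, word_value G x w))"
      using l Cons.IH by (simp add: continuous_map_paired)
    from continuous_map_compose[OF this mult] show ?case
      by (simp add: o_def)
  qed
qed

lemma (in group) elementary_algebraic_closedin: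
  assumes T: "group_topology G T" and "Hausdorff_space T"
    and "elementary_algebraic_in G E"
  shows "closedin T E"
proof -
  obtain w where w: "w \<in> group_words G" and E: "E = {x \<in> carrier G. word_value G x w = \<one>}"
    using assms(3) by (auto simp: elementary_algebraic_in_def)
  have top: "topspace T = carrier G"
    using T by (simp add: group_topology_def)
  have "closedin T {\<one>}"
    using assms(2) top by (simp add: closedin_Hausdorff_singleton)
  from closedin_continuous_map_preimage[OF continuous_map_word_value[OF T w] this]
  show ?thesis by (simp add: E top)
qed

lemma (in group) algebraic_imp_unconditionally_closed:
  assumes "algebraic_in G A"
  shows "unconditionally_closed_in G A"
  unfolding unconditionally_closed_in_def
proof (intro allI impI)
  fix T assume T: "group_topology G T \<and> Hausdorff_space T"
  obtain \<F> where \<F>: "\<And>B. B \<in> \<F> \<Longrightarrow> additively_algebraic_in G B"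
    and A: "A = carrier G \<inter> \<Inter>\<F>"
    using assms by (auto simp: algebraic_in_def)
  have "closedin T B" if "B \<in> \<F>" for B
    using \<F>[OF that] T elementary_algebraic_closedin
    by (auto simp: additively_algebraic_in_def intro!: closedin_Union)
  moreover have "closedin T (carrier G)"
    using T by (metis closedin_topspace group_topology_def)
  ultimately have "closedin T (\<Inter>(insert (carrier G) \<F>))"
    by (intro closedin_Inter) auto
  then show "closedin T A" by (simp add: A)
qed

section \<open>Group topologies from norms\<close>

text \<open>The metric \<open>N (x y\<inverse>)\<close> is translation invariant, so the operations are continuous, and the ball
  of radius \<open>r\<close> around \<open>x\<close> is the translate by \<open>x\<close> of \<open>{g. N g < r}\<close>. The last conclusion records the
  only consequence of this description used below: a point outside a closed set stays outside under
  translation by elements of small norm.\<close>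

lemma (in comm_group) group_norm_topology:
  fixes N :: "'a \<Rightarrow> real"
  assumes nonneg: "\<And>x. x \<in> carrier G \<Longrightarrow> 0 \<le> N x"
    and zero: "\<And>x. x \<in> carrier G \<Longrightarrow> N x = 0 \<longleftrightarrow> x = \<one>"
    and inverse: "\<And>x. x \<in> carrier G \<Longrightarrow> N (inv x) = N x"
    and triangle: "\<And>x y. \<lbrakk>x \<in> carrier G; y \<in> carrier G\<rbrakk> \<Longrightarrow> N (x \<otimes> y) \<le> N x + N y"
  obtains T where "group_topology G T" "Hausdorff_space T"
    "\<And>C x. \<lbrakk>closedin T C; x \<in> carrier G - C\<rbrakk> \<Longrightarrow> \<exists>r>0. \<forall>g\<in>carrier G. N g < r \<longrightarrow> x \<otimes> g \<notin> C"
proof -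
  \<comment> \<open>\<^locale>\<open>Metric_space\<close> asks for symmetry and nonnegativity off the carrier too, hence the default
    value.\<close>
  define d where
    "d x y = (if x \<in> carrier G \<and> y \<in> carrier G then N (x \<otimes> inv y) else 0)" for x y
  interpret M: Metric_space "carrier G" d
  proof
    show "0 \<le> d x y" for x y by (simp add: d_def nonneg)
    show "d x y = d y x" for x y
      using inverse[of "x \<otimes> inv y"] by (auto simp: d_def inv_mult m_comm)
    show "d x y = 0 \<longleftrightarrow> x = y" if "x \<in> carrier G" "y \<in> carrier G" for x y
      using that zero[of "x \<otimes> inv y"] inv_equality[of x "inv y"] by (auto simp: d_def)
    show "d x z \<le> d x y + d y z"
      if "x \<in> carrier G" "y \<in> carrier G" "z \<in> carrier G" for x y z
    proof -
      have "x \<otimes> inv z = (x \<otimes> inv y) \<otimes> (y \<otimes> inv z)"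
        using that by (metis inv_closed l_inv l_one m_assoc m_closed)
      then show ?thesis
        using that triangle[of "x \<otimes> inv y" "y \<otimes> inv z"] by (simp add: d_def)
    qed
  qed
  have d_mult: "d (x \<otimes> y) (x' \<otimes> y') \<le> d x x' + d y y'"
    if "x \<in> carrier G" "y \<in> carrier G" "x' \<in> carrier G" "y' \<in> carrier G" for x y x' y'
  proof -
    have "(x \<otimes> y) \<otimes> inv (x' \<otimes> y') = (x \<otimes> inv x') \<otimes> (y \<otimes> inv y')"
      using that by (simp add: inv_mult m_ac)
    then show ?thesis
      using that triangle[of "x \<otimes> inv x'" "y \<otimes> inv y'"] by (simp add: d_def)
  qed
  have d_inv: "d (inv x) (inv y) = d x y" if "x \<in> carrier G" "y \<in> carrier G" for x y
    using that inverse[of "x \<otimes> inv y"] by (simp add: d_def inv_mult)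
  have mult: "continuous_map (prod_topology M.mtopology M.mtopology) M.mtopology (\<lambda>(x, y). x \<otimes> y)"
  proof (subst M.continuous_map_to_metric, intro ballI allI impI)
    fix p and \<epsilon> :: real
    assume "p \<in> topspace (prod_topology M.mtopology M.mtopology)" and "0 < \<epsilon>"
    then obtain x y where p: "p = (x, y)" and xy: "x \<in> carrier G" "y \<in> carrier G" by auto
    let ?U = "M.mball x (\<epsilon> / 2) \<times> M.mball y (\<epsilon> / 2)"
    have "openin (prod_topology M.mtopology M.mtopology) ?U"
      by (simp add: openin_prod_Times_iff)
    moreover have "p \<in> ?U" using xy \<open>0 < \<epsilon>\<close> by (simp add: p)
    moreover have "(case q of (x, y) \<Rightarrow> x \<otimes> y) \<in> M.mball (case p of (x, y) \<Rightarrow> x \<otimes> y) \<epsilon>"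
      if "q \<in> ?U" for q
    proof -
      obtain x' y' where q: "q = (x', y')" by (cases q)
      show ?thesis using that d_mult[of x y x' y'] by (simp add: p q)
    qed
    ultimately show "\<exists>U. openin (prod_topology M.mtopology M.mtopology) U \<and> p \<in> U \<and>
        (\<forall>q\<in>U. (case q of (x, y) \<Rightarrow> x \<otimes> y) \<in> M.mball (case p of (x, y) \<Rightarrow> x \<otimes> y) \<epsilon>)"
      by blast
  qed
  have inv: "continuous_map M.mtopology M.mtopology (\<lambda>x. inv x)"
  proof (subst M.continuous_map_to_metric, intro ballI allI impI)
    fix x and \<epsilon> :: real
    assume "x \<in> topspace M.mtopology" and "0 < \<epsilon>"
    then have "x \<in> M.mball x \<epsilon>" "\<forall>y\<in>M.mball x \<epsilon>. inv y \<in> M.mball (inv x) \<epsilon>"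
      by (auto simp: d_inv)
    then show "\<exists>U. openin M.mtopology U \<and> x \<in> U \<and> (\<forall>y\<in>U. inv y \<in> M.mball (inv x) \<epsilon>)"
      using M.openin_mball by blast
  qed
  show thesis
  proof
    show "group_topology G M.mtopology"
      using mult inv by (simp add: group_topology_def)
    show "Hausdorff_space M.mtopology" by (rule M.Hausdorff_space_mtopology)
    fix C x assume C: "closedin M.mtopology C" and x: "x \<in> carrier G - C"
    then obtain r where r: "r > 0" "disjnt C (M.mball x r)"
      by (auto simp: M.closedin_metric)
    have "x \<otimes> g \<notin> C" if g: "g \<in> carrier G" "N g < r" for g
    proof -
      have "x \<otimes> inv (x \<otimes> g) = inv g"
        using x g by (simp add: inv_mult m_assoc[symmetric])
      then have "d x (x \<otimes> g) = N g" using x g by (simp add: d_def inverse)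
      then have "x \<otimes> g \<in> M.mball x r" using x g by simp
      then show ?thesis using r(2) by (auto simp: disjnt_iff)
    qed
    then show "\<exists>r>0. \<forall>g\<in>carrier G. N g < r \<longrightarrow> x \<otimes> g \<notin> C" using r(1) by blast
  qed
qed

section \<open>The norm of a lacunary sequence\<close>

definition (in comm_group) combination :: "(nat \<Rightarrow> 'a) \<Rightarrow> (nat \<Rightarrow> int) \<Rightarrow> nat \<Rightarrow> 'a" where
  "combination c e L = (\<Otimes>k\<in>{..<L}. c k [^] e k)"

text \<open>Only the last factor of a relation is required to vanish; then the relation shortens and the
  condition applies again. The bound \<open>2\<^bsup>k\<^esup>\<close> is matched to the weights \<open>1 / 2\<^bsup>k\<^esup>\<close> in
  \<open>sequence_norm\<close>: a representation of cost below \<open>1\<close> has \<open>\<bar>e k\<bar> < 2\<^bsup>k\<^esup>\<close>.\<close>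

definition (in comm_group) lacunary :: "(nat \<Rightarrow> 'a) \<Rightarrow> bool" where
  "lacunary c \<longleftrightarrow> range c \<subseteq> carrier G \<and>
     (\<forall>e K. (\<forall>k\<le>K. \<bar>e k\<bar> \<le> 2 ^ k) \<longrightarrow> combination c e (Suc K) = \<one> \<longrightarrow> c K [^] e K = \<one>)"

text \<open>This is the largest symmetric subadditive function bounded by \<open>1\<close> whose value at \<open>c k\<close> is at
  most \<open>1 / 2\<^bsup>k\<^esup>\<close>. Elements outside the subgroup generated by \<open>c\<close> have norm \<open>1\<close>, which makes
  that subgroup open. Finite support of \<open>e\<close> is encoded by vanishing from \<open>L\<close> on, so that two
  representations can be brought to a common length.\<close>

definition (in comm_group) sequence_norm :: "(nat \<Rightarrow> 'a) \<Rightarrow> 'a \<Rightarrow> real" where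
  "sequence_norm c g = Inf (insert 1
     {\<Sum>k<L. \<bar>real_of_int (e k)\<bar> / 2 ^ k | e L. (\<forall>k\<ge>L. e k = 0) \<and> combination c e L = g})"

context comm_group
begin

lemma combination_0 [simp]: "combination c e 0 = \<one>"
  by (simp add: combination_def)

lemma combination_Suc:
  assumes "range c \<subseteq> carrier G"
  shows "combination c e (Suc L) = c L [^] e L \<otimes> combination c e L"
proof -
  have "c k \<in> carrier G" for k using assms by auto
  then show ?thesis by (simp add: combination_def lessThan_Suc Pi_def)
qed

lemma combination_closed [simp]:
  assumes "range c \<subseteq> carrier G"
  shows "combination c e L \<in> carrier G"
proof -
  have "c k \<in> carrier G" for k using assms by auto
  then show ?thesis by (simp add: combination_def Pi_def)
qed

lemma combination_add:
  assumes "range c \<subseteq> carrier G"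
  shows "combination c (\<lambda>k. e k + f k) L = combination c e L \<otimes> combination c f L"
proof -
  have "c k \<in> carrier G" for k using assms by auto
  then show ?thesis by (simp add: combination_def Pi_def int_pow_mult)
qed

lemma combination_uminus:
  assumes "range c \<subseteq> carrier G"
  shows "combination c (\<lambda>k. - e k) L = inv (combination c e L)"
proof -
  have "combination c (\<lambda>k. - e k) L \<otimes> combination c e L = combination c (\<lambda>k. - e k + e k) L"
    by (rule combination_add[OF assms, symmetric])
  also have "\<dots> = \<one>" by (simp add: combination_def)
  finally show ?thesis using assms by (simp add: inv_equality)
qed

lemma combination_extend:
  assumes "range c \<subseteq> carrier G" "\<forall>k\<ge>L. e k = 0" "L \<le> M"
  shows "combination c e M = combination c e L"
  using assms(3)
proof (induction rule: dec_induct)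
  case (step n)
  then show ?case using assms(1,2) by (simp add: combination_Suc)
qed simp

lemma combination_cong:
  assumes "\<And>k. k < L \<Longrightarrow> e k = f k" and "range c \<subseteq> carrier G"
  shows "combination c e L = combination c f L"
  using assms(1) by (induction L) (simp_all add: combination_Suc[OF assms(2)])

lemma lacunary_terms:
  assumes "lacunary c" "\<And>k. k < L \<Longrightarrow> \<bar>e k\<bar> \<le> 2 ^ k" "combination c e L = \<one>" "k < L"
  shows "c k [^] e k = \<one>"
  using assms(2-)
proof (induction L)
  case (Suc L)
  have c: "range c \<subseteq> carrier G" using assms(1) by (simp add: lacunary_def)
  have "\<forall>k\<le>L. \<bar>e k\<bar> \<le> 2 ^ k" using Suc.prems(1) by simp
  then have top: "c L [^] e L = \<one>"
    using assms(1) Suc.prems(2) by (auto simp: lacunary_def)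
  then have "combination c e L = \<one>"
    using Suc.prems(2) c by (simp add: combination_Suc)
  then show ?case
    using Suc.IH Suc.prems top by (cases "k = L") auto
qed simp

lemma sequence_norm_le:
  assumes "\<forall>k\<ge>L. e k = 0" "combination c e L = g"
  shows "sequence_norm c g \<le> (\<Sum>k<L. \<bar>real_of_int (e k)\<bar> / 2 ^ k)"
  unfolding sequence_norm_def
proof (rule cInf_lower)
  show "bdd_below (insert 1 {\<Sum>k<L. \<bar>real_of_int (e k)\<bar> / 2 ^ k | e L.
      (\<forall>k\<ge>L. e k = 0) \<and> combination c e L = g})"
    by (rule bdd_belowI[of _ 0]) (auto intro: sum_nonneg)
qed (use assms in blast)

lemma sequence_norm_le_one: "sequence_norm c g \<le> 1"
  unfolding sequence_norm_def
proof (rule cInf_lower)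
  show "bdd_below (insert 1 {\<Sum>k<L. \<bar>real_of_int (e k)\<bar> / 2 ^ k | e L.
      (\<forall>k\<ge>L. e k = 0) \<and> combination c e L = g})"
    by (rule bdd_belowI[of _ 0]) (auto intro: sum_nonneg)
qed simp

lemma sequence_norm_nonneg: "0 \<le> sequence_norm c g"
  unfolding sequence_norm_def by (rule cInf_greatest) (auto intro: sum_nonneg)

lemma sequence_norm_lessE:
  assumes "sequence_norm c g < r" "r \<le> 1"
  obtains e L where "\<forall>k\<ge>L. e k = 0" "combination c e L = g"
    "(\<Sum>k<L. \<bar>real_of_int (e k)\<bar> / 2 ^ k) < r"
proof -
  have "\<exists>s\<in>insert 1 {\<Sum>k<L. \<bar>real_of_int (e k)\<bar> / 2 ^ k | e L.
      (\<forall>k\<ge>L. e k = 0) \<and> combination c e L = g}. s < r"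
    by (rule cInf_lessD) (use assms(1) in \<open>auto simp: sequence_norm_def\<close>)
  then show thesis using assms(2) that by force
qed

lemma sequence_norm_one: "sequence_norm c \<one> = 0"
  using sequence_norm_le[of 0 "\<lambda>_. 0" c \<one>] sequence_norm_nonneg[of c \<one>] by simp

text \<open>A single summand is at most the whole cost. The estimate is put in integer form so that for
  \<open>k \<le> j\<close> it forces \<open>e k = 0\<close>.\<close>

lemma coefficient_less:
  assumes "(\<Sum>k<L. \<bar>real_of_int (e k)\<bar> / 2 ^ k) < 1 / 2 ^ j" "\<forall>k\<ge>L. e k = 0"
  shows "\<bar>e k\<bar> * 2 ^ j < 2 ^ k"
proof (cases "k < L")
  case True
  have "\<bar>real_of_int (e k)\<bar> / 2 ^ k \<le> (\<Sum>k<L. \<bar>real_of_int (e k)\<bar> / 2 ^ k)"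
    using True by (intro member_le_sum) auto
  then have "\<bar>real_of_int (e k)\<bar> / 2 ^ k < 1 / 2 ^ j" using assms(1) by simp
  then have "real_of_int (\<bar>e k\<bar> * 2 ^ j) < real_of_int (2 ^ k)" by (simp add: field_simps)
  then show ?thesis by (simp only: of_int_less_iff)
qed (use assms(2) in simp)

text \<open>Positivity of the norm, where lacunarity enters: two representations of \<open>g\<close> with essentially
  disjoint supports are compared.\<close>

lemma sequence_norm_eq_zero:
  assumes c: "lacunary c" and zero: "sequence_norm c g = 0"
  shows "g = \<one>"
proof -
  have car: "range c \<subseteq> carrier G" using c by (simp add: lacunary_def)
  obtain e L where e: "\<forall>k\<ge>L. e k = 0" "combination c e L = g"
    "(\<Sum>k<L. \<bar>real_of_int (e k)\<bar> / 2 ^ k) < 1 / 2 ^ 0"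
    by (rule sequence_norm_lessE[of c g "1 / 2 ^ 0"]) (use zero in auto)
  obtain f M where f: "\<forall>k\<ge>M. f k = 0" "combination c f M = g"
    "(\<Sum>k<M. \<bar>real_of_int (f k)\<bar> / 2 ^ k) < 1 / 2 ^ L"
    by (rule sequence_norm_lessE[of c g "1 / 2 ^ L"]) (use zero in auto)
  have f0: "f k = 0" if "k < L" for k
  proof (rule ccontr)
    assume "f k \<noteq> 0"
    then have "(1::int) * 2 ^ L \<le> \<bar>f k\<bar> * 2 ^ L" by (intro mult_right_mono) auto
    moreover have "(2::int) ^ k \<le> 2 ^ L" using that by (intro power_increasing) auto
    ultimately show False using coefficient_less[OF f(3,1), of k] by linarith
  qed
  \<comment> \<open>The exponents of the quotient of the two representations: \<open>e\<close> below \<open>L\<close> and \<open>- f\<close> from \<open>L\<close> on.\<close>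
  define h where "h k = e k + - f k" for k
  let ?K = "max L M"
  have "combination c h ?K = combination c e ?K \<otimes> inv (combination c f ?K)"
    unfolding h_def by (simp only: combination_add[OF car] combination_uminus[OF car])
  also have "\<dots> = g \<otimes> inv g"
    using combination_extend[OF car e(1), of ?K] combination_extend[OF car f(1), of ?K] e f by simp
  also have "\<dots> = \<one>" using e(2) car by auto
  finally have rel: "combination c h ?K = \<one>" .
  have bound: "\<bar>h k\<bar> \<le> 2 ^ k" for k
  proof (cases "k < L")
    case True
    then show ?thesis using coefficient_less[OF e(3,1), of k] f0 by (simp add: h_def)
  next
    case False
    have "\<bar>f k\<bar> * 1 \<le> \<bar>f k\<bar> * 2 ^ L" by (intro mult_left_mono) auto
    then show ?thesis using False coefficient_less[OF f(3,1), of k] e(1) by (simp add: h_def)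
  qed
  have "c k [^] e k = \<one>" if "k < L" for k
    using lacunary_terms[OF c bound rel, of k] that f0 by (simp add: h_def)
  then have "combination c e L = \<one>"
    unfolding combination_def by (intro finprod_one_eqI) simp
  then show ?thesis using e(2) by simp
qed

lemma sequence_norm_inv_le:
  assumes "range c \<subseteq> carrier G" "g \<in> carrier G"
  shows "sequence_norm c (inv g) \<le> sequence_norm c g"
proof (rule ccontr)
  assume "\<not> ?thesis"
  then obtain e L where e: "\<forall>k\<ge>L. e k = 0" "combination c e L = g"
    "(\<Sum>k<L. \<bar>real_of_int (e k)\<bar> / 2 ^ k) < sequence_norm c (inv g)"
    using sequence_norm_lessE[of c g "sequence_norm c (inv g)"] sequence_norm_le_one
    by (metis not_le)
  then have "sequence_norm c (inv g) \<le> (\<Sum>k<L. \<bar>real_of_int (- e k)\<bar> / 2 ^ k)"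
    by (intro sequence_norm_le) (auto simp: combination_uminus assms)
  then show False using e(3) by simp
qed

lemma sequence_norm_mult_le:
  assumes "range c \<subseteq> carrier G" "x \<in> carrier G" "y \<in> carrier G"
  shows "sequence_norm c (x \<otimes> y) \<le> sequence_norm c x + sequence_norm c y"
proof (rule field_le_epsilon)
  fix \<epsilon> :: real assume "0 < \<epsilon>"
  show "sequence_norm c (x \<otimes> y) \<le> sequence_norm c x + sequence_norm c y + \<epsilon>"
  proof (cases "sequence_norm c x + \<epsilon> / 2 \<le> 1 \<and> sequence_norm c y + \<epsilon> / 2 \<le> 1")
    case False
    \<comment> \<open>The right-hand side already reaches the cap \<open>1\<close>.\<close>
    then show ?thesis
      using sequence_norm_le_one[of c "x \<otimes> y"] sequence_norm_nonneg[of c x]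
        sequence_norm_nonneg[of c y] \<open>0 < \<epsilon>\<close> by linarith
  next
    case True
    obtain e L where e: "\<forall>k\<ge>L. e k = 0" "combination c e L = x"
      "(\<Sum>k<L. \<bar>real_of_int (e k)\<bar> / 2 ^ k) < sequence_norm c x + \<epsilon> / 2"
      by (rule sequence_norm_lessE[of c x "sequence_norm c x + \<epsilon> / 2"])
        (use True \<open>0 < \<epsilon>\<close> in auto)
    obtain f M where f: "\<forall>k\<ge>M. f k = 0" "combination c f M = y"
      "(\<Sum>k<M. \<bar>real_of_int (f k)\<bar> / 2 ^ k) < sequence_norm c y + \<epsilon> / 2"
      by (rule sequence_norm_lessE[of c y "sequence_norm c y + \<epsilon> / 2"])
        (use True \<open>0 < \<epsilon>\<close> in auto)
    let ?K = "max L M"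
    have cost: "(\<Sum>k<?K. \<bar>real_of_int (e k)\<bar> / 2 ^ k) = (\<Sum>k<L. \<bar>real_of_int (e k)\<bar> / 2 ^ k)"
      "(\<Sum>k<?K. \<bar>real_of_int (f k)\<bar> / 2 ^ k) = (\<Sum>k<M. \<bar>real_of_int (f k)\<bar> / 2 ^ k)"
      using e(1) f(1) by (auto intro!: sum.mono_neutral_right) (meson not_le)+
    have "combination c (\<lambda>k. e k + f k) ?K = x \<otimes> y"
      using combination_extend[OF assms(1) e(1), of ?K] combination_extend[OF assms(1) f(1), of ?K]
        e(2) f(2) by (simp add: combination_add assms(1))
    then have "sequence_norm c (x \<otimes> y) \<le> (\<Sum>k<?K. \<bar>real_of_int (e k + f k)\<bar> / 2 ^ k)"
      using e(1) f(1) by (intro sequence_norm_le) auto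
    also have "\<dots> \<le> (\<Sum>k<?K. \<bar>real_of_int (e k)\<bar> / 2 ^ k + \<bar>real_of_int (f k)\<bar> / 2 ^ k)"
      by (intro sum_mono) (simp add: add_divide_distrib[symmetric] divide_right_mono)
    also have "\<dots> < sequence_norm c x + \<epsilon> / 2 + (sequence_norm c y + \<epsilon> / 2)"
      unfolding sum.distrib cost using e(3) f(3) by (rule add_strict_mono)
    finally show ?thesis by simp
  qed
qed

lemma sequence_norm_term_le:
  assumes "range c \<subseteq> carrier G"
  shows "sequence_norm c (c k) \<le> 1 / 2 ^ k"
proof -
  define e :: "nat \<Rightarrow> int" where "e i = (if i = k then 1 else 0)" for i
  have "combination c e k = \<one>"
    unfolding combination_def by (intro finprod_one_eqI) (simp add: e_def)
  then have "combination c e (Suc k) = c k"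
    using assms by (simp add: combination_Suc e_def image_subset_iff)
  moreover have "\<forall>i\<ge>Suc k. e i = 0" by (simp add: e_def)
  ultimately have "sequence_norm c (c k) \<le> (\<Sum>i<Suc k. \<bar>real_of_int (e i)\<bar> / 2 ^ i)"
    by (intro sequence_norm_le)
  also have "\<dots> = 1 / 2 ^ k" by (simp add: e_def)
  finally show ?thesis .
qed

text \<open>The conclusion is the form in which \<open>c k \<longlonglongrightarrow> 1\<close> is needed: \<open>x\<close> is a limit of the points
  \<open>x \<otimes> c k\<close>, so a closed set containing all of them contains \<open>x\<close>.\<close>

lemma lacunary_convergent_topology:
  assumes "lacunary c"
  obtains T where "group_topology G T" "Hausdorff_space T"
    "\<And>C x. \<lbrakk>closedin T C; x \<in> carrier G - C\<rbrakk> \<Longrightarrow> \<exists>k. x \<otimes> c k \<notin> C"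
proof -
  have car: "range c \<subseteq> carrier G" using assms by (simp add: lacunary_def)
  have inverse: "sequence_norm c (inv x) = sequence_norm c x" if "x \<in> carrier G" for x
    using sequence_norm_inv_le[OF car that] sequence_norm_inv_le[OF car inv_closed[OF that]] that
    by simp
  have zero: "sequence_norm c x = 0 \<longleftrightarrow> x = \<one>" for x
    using sequence_norm_eq_zero[OF assms] sequence_norm_one by blast
  obtain T where T: "group_topology G T" "Hausdorff_space T"
    and sep: "\<And>C x. \<lbrakk>closedin T C; x \<in> carrier G - C\<rbrakk> \<Longrightarrow>
      \<exists>r>0. \<forall>g\<in>carrier G. sequence_norm c g < r \<longrightarrow> x \<otimes> g \<notin> C"
    by (rule group_norm_topology[of "sequence_norm c"])
      (use sequence_norm_nonneg inverse sequence_norm_mult_le[OF car] zero in blast)+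
  have "\<exists>k. x \<otimes> c k \<notin> C" if C: "closedin T C" "x \<in> carrier G - C" for C x
  proof -
    obtain r where r: "r > 0" "\<forall>g\<in>carrier G. sequence_norm c g < r \<longrightarrow> x \<otimes> g \<notin> C"
      using sep[OF C] by blast
    obtain k where "(1 / 2) ^ k < r" using real_arch_pow_inv[of r "1 / 2"] r(1) by auto
    then have "sequence_norm c (c k) < r"
      using sequence_norm_term_le[OF car, of k] by (simp add: power_one_over)
    then show ?thesis using r(2) car by blast
  qed
  then show thesis using T that by blast
qed

end

section \<open>Sets that accumulate algebraically at the identity\<close>

text \<open>For \<open>a \<noteq> 1\<close> the set of solutions of \<open>x\<^bsup>m\<^esup> = a\<close> is an elementary algebraic set that misses
  \<open>1\<close>. In an Abelian group every elementary algebraic set is the solution set of \<open>x\<^bsup>m\<^esup> = a\<close> for some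
  \<open>m\<close> and \<open>a\<close>, so the condition says that \<open>1\<close> lies outside the closure of \<open>X\<close> in the topology
  whose closed sets are the algebraic sets.\<close>

definition (in comm_group) separated_from_one :: "'a set \<Rightarrow> bool" where
  "separated_from_one X \<longleftrightarrow> (\<exists>S :: (nat \<times> 'a) set. finite S \<and>
     (\<forall>(m, a)\<in>S. a \<in> carrier G \<and> a \<noteq> \<one>) \<and> (\<forall>x\<in>X. \<exists>(m, a)\<in>S. x [^] m = a))"

context comm_group
begin

lemma separated_from_one_empty: "separated_from_one {}"
  unfolding separated_from_one_def by (rule exI[of _ "{}"]) simp

lemma separated_from_one_subset:
  "separated_from_one Y \<Longrightarrow> X \<subseteq> Y \<Longrightarrow> separated_from_one X"
  unfolding separated_from_one_def by (meson subsetD)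

lemma separated_from_one_Un:
  assumes "separated_from_one X" "separated_from_one Y"
  shows "separated_from_one (X \<union> Y)"
proof -
  obtain S S' :: "(nat \<times> 'a) set" where "finite S" "\<forall>(m, a)\<in>S. a \<in> carrier G \<and> a \<noteq> \<one>" "\<forall>x\<in>X. \<exists>(m, a)\<in>S. x [^] m = a"
    "finite S'" "\<forall>(m, a)\<in>S'. a \<in> carrier G \<and> a \<noteq> \<one>" "\<forall>x\<in>Y. \<exists>(m, a)\<in>S'. x [^] m = a"
    using assms unfolding separated_from_one_def by blast
  then show ?thesis
    unfolding separated_from_one_def by (intro exI[of _ "S \<union> S'"]) blast
qed

lemma separated_from_one_UN:
  assumes "finite I" "\<And>i. i \<in> I \<Longrightarrow> separated_from_one (X i)"
  shows "separated_from_one (\<Union>i\<in>I. X i)"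
  using assms
  by (induction I) (simp_all add: separated_from_one_empty separated_from_one_Un)

lemma separated_from_one_power_eq:
  "a \<in> carrier G \<Longrightarrow> a \<noteq> \<one> \<Longrightarrow> separated_from_one {x \<in> X. x [^] (m::nat) = a}"
  unfolding separated_from_one_def by (intro exI[of _ "{(m, a)}"]) auto

text \<open>Descent along divisors: among the elements killed by \<open>n\<close>, those killed by \<open>m\<close> are exactly
  those killed by \<open>gcd n m\<close>, a proper divisor of \<open>n\<close> unless \<open>n dvd m\<close>. So \<open>n\<close> is the least positive
  exponent for which separation fails, or \<open>0\<close>, imposing no condition, if there is none.\<close>

lemma minimal_exponent:
  assumes B: "B \<subseteq> carrier G" and "\<not> separated_from_one B"
  obtains n :: nat where "\<not> separated_from_one {b \<in> B. b [^] n = \<one>}"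
    "\<And>m::nat. \<not> n dvd m \<Longrightarrow> separated_from_one {b \<in> B. b [^] n = \<one> \<and> b [^] m = \<one>}"
proof -
  let ?P = "\<lambda>n::nat. 0 < n \<and> \<not> separated_from_one {b \<in> B. b [^] n = \<one>}"
  show thesis
  proof (cases "\<exists>n. ?P n")
    case False
    show thesis
    proof (rule that[of 0])
      show "\<not> separated_from_one {b \<in> B. b [^] (0::nat) = \<one>}" using assms(2) by simp
      show "separated_from_one {b \<in> B. b [^] (0::nat) = \<one> \<and> b [^] m = \<one>}" if "\<not> 0 dvd m" for m :: nat
        using False[unfolded not_ex, THEN spec, of m] that by simp
    qed
  next
    case True
    define n where "n = (LEAST n. ?P n)"
    have n: "?P n" unfolding n_def by (rule LeastI_ex[OF True])
    show thesis
    proof (rule that)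
      show "\<not> separated_from_one {b \<in> B. b [^] n = \<one>}" using n by simp
      fix m :: nat assume m: "\<not> n dvd m"
      have "gcd n m < n"
        using n m gcd_le1_nat[of n m] gcd_dvd2[of n m] by (metis le_neq_implies_less neq0_conv)
      then have "\<not> ?P (gcd n m)" unfolding n_def by (rule not_less_Least)
      then have "separated_from_one {b \<in> B. b [^] gcd n m = \<one>}" using n by simp
      moreover have "{b \<in> B. b [^] n = \<one> \<and> b [^] m = \<one>} \<subseteq> {b \<in> B. b [^] gcd n m = \<one>}"
        using B by (auto simp: pow_eq_id subset_iff)
      ultimately show "separated_from_one {b \<in> B. b [^] n = \<one> \<and> b [^] m = \<one>}"
        by (rule separated_from_one_subset)
    qed
  qed
qed

text \<open>The elements to avoid form a finite union of sets \<open>{b. b\<^bsup>m\<^esup> = f}\<close> with \<open>n\<close> not dividing \<open>m\<close>. Each is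
  separated from \<open>1\<close>: by definition if \<open>f \<noteq> 1\<close>, and by the minimality of \<open>n\<close> if \<open>f = 1\<close>. Hence their
  union cannot exhaust the elements of \<open>B\<close> killed by \<open>n\<close>.\<close>

lemma generic_element:
  fixes n :: nat and M :: nat
  assumes "B \<subseteq> carrier G" and nsep: "\<not> separated_from_one {b \<in> B. b [^] n = \<one>}"
    and sep: "\<And>m::nat. \<not> n dvd m \<Longrightarrow> separated_from_one {b \<in> B. b [^] n = \<one> \<and> b [^] m = \<one>}"
    and F: "finite F" "F \<subseteq> carrier G"
  obtains b where "b \<in> B" "b [^] n = \<one>" "\<And>m. m \<le> M \<Longrightarrow> b [^] m \<in> F \<Longrightarrow> b [^] m = \<one>"
proof -
  let ?B = "{b \<in> B. b [^] n = \<one>}"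
  let ?bad = "\<Union>m\<in>{m. m \<le> M \<and> \<not> n dvd m}. \<Union>f\<in>F. {b \<in> ?B. b [^] m = f}"
  have "separated_from_one {b \<in> ?B. b [^] m = f}" if "\<not> n dvd m" "f \<in> F" for m f
  proof (cases "f = \<one>")
    case True
    then show ?thesis using sep[OF that(1)] by simp
  next
    case False
    then show ?thesis using that F(2) separated_from_one_power_eq[of f ?B m] by auto
  qed
  then have "separated_from_one ?bad"
    using F(1) by (intro separated_from_one_UN) auto
  then have "\<not> ?B \<subseteq> ?bad" using nsep separated_from_one_subset by blast
  then obtain b where b: "b \<in> ?B" "b \<notin> ?bad" by blast
  show thesis
  proof (rule that)
    show "b \<in> B" "b [^] n = \<one>" using b(1) by auto
    fix m assume m: "m \<le> M" "b [^] m \<in> F"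
    then have "n dvd m" using b by blast
    then obtain q where "m = n * q" by (rule dvdE)
    then show "b [^] m = \<one>"
      using b(1) assms(1) nat_pow_pow[of b n q] by (auto simp: subset_iff)
  qed
qed

text \<open>The recursion carries, besides the term \<open>c k\<close>, the finite set of all products
  \<open>\<Prod> c\<^sub>i\<^bsup>e i\<^esup>\<close> over \<open>i < k\<close> with \<open>\<bar>e i\<bar> \<le> 2\<^bsup>i\<^esup>\<close>. If no nontrivial power \<open>c\<^sub>k\<^bsup>m\<^esup>\<close> with
  \<open>\<bar>m\<bar> \<le> 2\<^bsup>k\<^esup>\<close> lies in it, the last factor of a relation is trivial.\<close>

lemma lacunary_sequence_exists:
  assumes B: "B \<subseteq> carrier G" and "\<not> separated_from_one B"
  obtains c where "lacunary c" "range c \<subseteq> B"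
proof -
  obtain n :: nat where n: "\<not> separated_from_one {b \<in> B. b [^] n = \<one>}"
    "\<And>m::nat. \<not> n dvd m \<Longrightarrow> separated_from_one {b \<in> B. b [^] n = \<one> \<and> b [^] m = \<one>}"
    by (rule minimal_exponent[OF assms]) (assumption | rule that)+
  \<comment> \<open>Including the inverses of \<open>F\<close> lets natural exponents \<open>m\<close> account for the negative ones.\<close>
  define good where "good k F b \<longleftrightarrow> finite F \<and> F \<subseteq> carrier G \<and> b \<in> B \<and>
    (\<forall>m\<le>2 ^ k. b [^] (m::nat) \<in> F \<union> (\<lambda>x. inv x) ` F \<longrightarrow> b [^] m = \<one>)" for k :: nat and F b
  define next_set where
    "next_set k F b = (\<lambda>(j, f). b [^] j \<otimes> f) ` ({- (2 ^ k)..(2 ^ k)::int} \<times> F)" for k :: nat and F b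
  have extend: "\<exists>b. good k F b" if "finite F" "F \<subseteq> carrier G" for k F
  proof -
    let ?F = "F \<union> (\<lambda>x. inv x) ` F"
    have F: "finite ?F" "?F \<subseteq> carrier G" using that by auto
    obtain b where "b \<in> B" "\<And>m::nat. m \<le> 2 ^ k \<Longrightarrow> b [^] m \<in> ?F \<Longrightarrow> b [^] m = \<one>"
      by (rule generic_element[OF B n(1) _ F]) (erule n(2), blast)
    then show ?thesis using that by (auto simp: good_def)
  qed
  have "\<exists>s. \<forall>k. (good k (fst (s k)) (snd (s k)) \<and> (k = 0 \<longrightarrow> fst (s k) = {\<one>})) \<and>
      fst (s (Suc k)) = next_set k (fst (s k)) (snd (s k))"
  proof (rule dependent_nat_choice)
    show "\<exists>x. good 0 (fst x) (snd x) \<and> (0 = (0::nat) \<longrightarrow> fst x = {\<one>})"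
      using extend[of "{\<one>}" 0] by auto
    fix x and k :: nat
    assume "good k (fst x) (snd x) \<and> (k = 0 \<longrightarrow> fst x = {\<one>})"
    then have "finite (next_set k (fst x) (snd x))" "next_set k (fst x) (snd x) \<subseteq> carrier G"
      using B by (auto simp: good_def next_set_def subset_iff)
    from extend[OF this, of "Suc k"]
    show "\<exists>y. (good (Suc k) (fst y) (snd y) \<and> (Suc k = 0 \<longrightarrow> fst y = {\<one>})) \<and>
        fst y = next_set k (fst x) (snd x)"
      by auto
  qed
  then obtain s where good: "\<And>k. good k (fst (s k)) (snd (s k))" and s0: "fst (s 0) = {\<one>}"
    and sS: "\<And>k. fst (s (Suc k)) = next_set k (fst (s k)) (snd (s k))"
    by metis
  define c where "c k = snd (s k)" for k
  have cB: "range c \<subseteq> B" using good by (auto simp: c_def good_def)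
  then have car: "range c \<subseteq> carrier G" using B by blast
  have mem: "combination c e K \<in> fst (s K)" if "\<forall>k<K. \<bar>e k\<bar> \<le> 2 ^ k" for e K
    using that
  proof (induction K)
    case (Suc K)
    then have "e K \<in> {- (2 ^ K)..2 ^ K}" "combination c e K \<in> fst (s K)" by (auto simp: abs_le_iff)
    moreover have "combination c e (Suc K) = snd (s K) [^] e K \<otimes> combination c e K"
      by (simp add: combination_Suc[OF car]) (simp add: c_def)
    ultimately show ?case
      unfolding sS next_set_def by (intro image_eqI[of _ _ "(e K, combination c e K)"]) auto
  qed (simp add: s0)
  have "c K [^] e K = \<one>" if e: "\<forall>k\<le>K. \<bar>e k\<bar> \<le> 2 ^ k" and rel: "combination c e (Suc K) = \<one>" for e K
  proof -
    let ?f = "combination c e K" and ?m = "nat \<bar>e K\<bar>"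
    have f: "?f \<in> fst (s K)" using mem e by simp
    have cK: "c K \<in> carrier G" using car by auto
    have "c K [^] e K \<otimes> ?f = \<one>" using rel by (simp add: combination_Suc[OF car])
    then have eq: "c K [^] e K = inv ?f" using cK car by (simp add: inv_equality[symmetric])
    have m: "?m \<le> 2 ^ K" using e by (simp add: nat_le_iff)
    have pow: "c K [^] ?m = (if 0 \<le> e K then c K [^] e K else inv (c K [^] e K))"
      using cK by (auto simp: int_pow_int[symmetric] int_pow_neg[symmetric])
    then have "c K [^] ?m \<in> fst (s K) \<union> (\<lambda>x. inv x) ` fst (s K)"
      using eq f car by auto
    then have "c K [^] ?m = \<one>" using good[of K] m unfolding good_def c_def by blast
    then show ?thesis using pow cK by (auto split: if_splits)
  qed
  then have "lacunary c" using car by (simp add: lacunary_def)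
  then show thesis using cB that by blast
qed

end

section \<open>Unconditionally closed sets are algebraic\<close>

context comm_group
begin

text \<open>These are the translates by \<open>p\<close> of the sets in the definition of \<open>separated_from_one\<close>. The word
  is \<open>m\<close> copies of \<open>p\<inverse> x\<close> followed by \<open>a\<inverse>\<close>.\<close>

lemma elementary_algebraic_power_coset:
  fixes m :: nat
  assumes "p \<in> carrier G" "a \<in> carrier G"
  shows "elementary_algebraic_in G {x \<in> carrier G. (inv p \<otimes> x) [^] m = a}"
proof -
  define w where "w = concat (replicate m [Const (inv p), Var]) @ [Const (inv a)]"
  have "w \<in> group_words G"
    using assms by (auto simp: w_def group_words_def in_lists_conv_set)
  moreover have "word_value G x w = (inv p \<otimes> x) [^] m \<otimes> inv a" if "x \<in> carrier G" for x
    unfolding w_def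
  proof (induction m)
    case (Suc m)
    have "(inv p \<otimes> x) [^] Suc m = (inv p \<otimes> x) \<otimes> (inv p \<otimes> x) [^] m"
      using assms that nat_pow_Suc2 by simp
    then show ?case using Suc assms that by (simp add: m_assoc)
  qed (use assms in simp)
  moreover have "y \<otimes> inv a = \<one> \<longleftrightarrow> y = a" if "y \<in> carrier G" for y
    using assms(2) that by (metis inv_closed inv_equality inv_inv r_inv)
  ultimately have "{x \<in> carrier G. (inv p \<otimes> x) [^] m = a} = {x \<in> carrier G. word_value G x w = \<one>}"
    using assms by auto
  then show ?thesis
    unfolding elementary_algebraic_in_def using \<open>w \<in> group_words G\<close> by blast
qed

lemma unconditionally_closed_imp_algebraic:
  assumes A: "A \<subseteq> carrier G" and closed: "unconditionally_closed_in G A"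
  shows "algebraic_in G A"
proof -
  let ?\<F> = "{X. additively_algebraic_in G X \<and> A \<subseteq> X}"
  have "p \<in> A" if p: "p \<in> carrier G" "\<And>X. X \<in> ?\<F> \<Longrightarrow> p \<in> X" for p
  proof (rule ccontr)
    assume "p \<notin> A"
    define B where "B = {b \<in> carrier G. p \<otimes> b \<in> A}"
    have "\<not> separated_from_one B"
    proof
      assume "separated_from_one B"
      then obtain S :: "(nat \<times> 'a) set" where S: "finite S"
        "\<And>m a. (m, a) \<in> S \<Longrightarrow> a \<in> carrier G \<and> a \<noteq> \<one>" "\<And>x. x \<in> B \<Longrightarrow> \<exists>(m, a)\<in>S. x [^] m = a"
        unfolding separated_from_one_def by blast
      let ?\<E> = "(\<lambda>(m, a). {x \<in> carrier G. (inv p \<otimes> x) [^] m = a}) ` S"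
      have "additively_algebraic_in G (\<Union>?\<E>)"
        unfolding additively_algebraic_in_def
        using S elementary_algebraic_power_coset[OF p(1)] by (intro exI[of _ ?\<E>]) auto
      moreover have "A \<subseteq> \<Union>?\<E>"
      proof
        fix x assume x: "x \<in> A"
        then have "inv p \<otimes> x \<in> B" using A p(1) by (auto simp: B_def m_assoc[symmetric])
        then show "x \<in> \<Union>?\<E>" using S(3)[of "inv p \<otimes> x"] x A by auto
      qed
      ultimately have "p \<in> \<Union>?\<E>" using p(2) by blast
      then show False using S(2)[of _ \<one>] p(1) by auto
    qed
    moreover have "B \<subseteq> carrier G" by (auto simp: B_def)
    ultimately obtain c where c: "lacunary c" "range c \<subseteq> B"
      using lacunary_sequence_exists by blast
    obtain T where T: "group_topology G T" "Hausdorff_space T"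
      and sep: "\<And>C x. \<lbrakk>closedin T C; x \<in> carrier G - C\<rbrakk> \<Longrightarrow> \<exists>k. x \<otimes> c k \<notin> C"
      using lacunary_convergent_topology[OF c(1)] by blast
    have "closedin T A" using closed T by (simp add: unconditionally_closed_in_def)
    then obtain k where "p \<otimes> c k \<notin> A" using sep p(1) \<open>p \<notin> A\<close> by blast
    then show False using c(2) by (auto simp: B_def)
  qed
  then have "A = carrier G \<inter> \<Inter>?\<F>" using A by blast
  then show ?thesis unfolding algebraic_in_def by (intro exI[of _ ?\<F>]) auto
qed

end

theorem corollary1:
  fixes G :: "('a, 'b) monoid_scheme" and A :: "'a set"
  assumes "comm_group G" and "A \<subseteq> carrier G"
  shows "unconditionally_closed_in G A \<longleftrightarrow> algebraic_in G A"
proof -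
  interpret comm_group G by fact
  show ?thesis
    using unconditionally_closed_imp_algebraic[OF assms(2)] algebraic_imp_unconditionally_closed
    by blast
qed

end
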